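(* Consider an SS-CTM with an inflow vector $r\in\mathbb R_{\ge0}^K$. Let $\mathsf p=(\mathsf p_i)_{i\in\mathcal I}$ be the steady-state distribution of the mode process, i.e. the solution of $\mathsf p\Lambda=0$, $\sum_{i}\mathsf p_i=1$, $\mathsf p\ge0$. Let $\underline n=(\underline n_1,\ldots,\underline n_K)$, the spillback-adjusted capacities $\widetilde F_k^i(\underline n,r)$, and the coefficients $\beta_h^k$ be as defined in the context. If the SS-CTM is stable, i.e. if there is a finite constant $C$ such that for each initial condition $(I(0),N(0))=(i,n)\in\mathcal I\times\mathcal N$ $$\limsup_{t\to\infty}\frac1t\int_0^t\mathsf E\big[\exp(|N(\tau)|)\big]\,d\tau\le C,\qquad |N(\tau)|=\sum_{k=1}^KN_k(\tau),$$ then $$\sum_{h=1}^k\beta_h^k r_h\le\sum_{i\in\mathcal I}\mathsf p_i\,\widetilde F_k^i(\underline n,r),\qquad k=1,2,\ldots,K.$$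
   Context: Stochastic switching cell transmission model (SS-CTM). A freeway consists of $K$ cells of unit length. The parameters are: free-flow speed $v>0$, congestion-wave speed $w>0$, jam density $n^{\max}>0$ (for cells $2,\ldots,K$; cell 1 includes an infinite buffer), mainline ratios $\beta_1,\ldots,\beta_K\in(0,1]$, a finite set of modes $\mathcal I$ with $|\mathcal I|=m$, and for each mode $i\in\mathcal I$ a vector of nonnegative cell capacities $F^i=[F_1^i,\ldots,F_K^i]^T$. Put $F_k^{\min}=\min_{i\in\mathcal I}F_k^i$ and $F_k^{\max}=\max_{i\in\mathcal I}F_k^i$. Standing assumptions: $F_k^{\max}=F^{\max}$ is the same for all $k$, and $F^{\max}\le\frac{vw}{v+w}n^{\max}$. The mode $I(t)$ is a continuous-time Markov chain on $\mathcal I$ with constant transition rates $\lambda_{ij}\ge 0$ ($\lambda_{ii}=0$), assumed ergodic; $\Lambda$ is its transition rate matrix, with off-diagonal entries $\lambda_{ij}$ and diagonal entries $-\nu_i$, $\nu_i=\sum_j\lambda_{ij}$. The continuous state (traffic densities) is $N(t)=[N_1(t),\ldots,N_K(t)]^T\in\mathcal N=[0,\infty)\times[0,n^{\max}]^{K-1}$. The inflow vector $r=[r_1,\ldots,r_K]^T\in\mathbb R_{\ge0}^K$ is constant in time. Sending and receiving flows: $S_k(i,n_k)=\min\{vn_k,F_k^i\}$ for $k=1,\ldots,K$; $R_k(n_k)=w(n^{\max}-n_k)$ for $k=2,\ldots,K$. Flows: $f_0=0$; $f_k(i,n_k,n_{k+1},r_{k+1})=\min\{\beta_kS_k(i,n_k),(R_{k+1}(n_{k+1})-r_{k+1})_+\}$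 for $k=1,\ldots,K-1$; $f_K(i,n_K)=\beta_KS_K(i,n_K)$. Here $(x)_+=\max\{x,0\}$. The vector field $G(i,n,r)\in\mathbb R^K$ has components $G_k(i,n,r)=f_{k-1}+r_k-f_k/\beta_k$, $k=1,\ldots,K$ (flows evaluated at $(i,n,r)$). The SS-CTM started from $(I(0),N(0))=(i,n)\in\mathcal I\times\mathcal N$ is the process $(I(t),N(t))$ with $N(t)=n+\int_0^tG(I(\tau),N(\tau),r)\,d\tau$. Lower boundaries: $\underline n_1=\min\{\frac{r_1}{v},\frac{F^{\max}}{v}\}$ and, for $k=2,\ldots,K$, $\underline n_k=\min\{\beta_{k-1}\underline n_{k-1}+\frac{r_k}{v},\ \frac{\beta_{k-1}F_{k-1}^{\min}+r_k}{v},\ \frac{F^{\max}}{v}\}$. Spillback-adjusted capacities: for each $i\in\mathcal I$, $\widetilde F_k^i(\underline n,r)=\min\{F_k^i,\ \frac1{\beta_k}(R_{k+1}(\underline n_{k+1})-r_{k+1})_+\}$ for $k=1,\ldots,K-1$, and $\widetilde F_K^i(\underline n,r)=F_K^i$. Coefficients: $\beta_k^k=1$ and $\beta_{k_1}^{k_2}=\prod_{h=k_1}^{k_2-1}\beta_h$ for $1\le k_1\le k_2-1$, $k_2=2,\ldots,K$. *)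

theory Defs
  imports "HOL-Probability.Probability"
begin

text \<open>Cells are numbered \<open>1, \<dots>, num_cells\<close>; vectors indexed by cells are functions on \<open>nat\<close>,
  of which only the values on \<open>{1..num_cells}\<close> matter. The modes are the elements of a finite
  type.\<close>

record 'i ctm =
  num_cells :: nat
  ff_speed :: real  \<comment> \<open>\<open>v\<close>\<close>
  cw_speed :: real  \<comment> \<open>\<open>w\<close>\<close>
  jam_density :: real  \<comment> \<open>\<open>n\<^sup>m\<^sup>a\<^sup>x\<close>\<close>
  ratio :: "nat \<Rightarrow> real"  \<comment> \<open>\<open>\<beta>\<^sub>k\<close>\<close>
  cap :: "'i \<Rightarrow> nat \<Rightarrow> real"  \<comment> \<open>\<open>F\<^sub>k\<^sup>i\<close>\<close>
  rate :: "'i \<Rightarrow> 'i \<Rightarrow> real"  \<comment> \<open>\<open>\<lambda>\<^sub>i\<^sub>j\<close>\<close>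

definition cap_min :: "'i::finite ctm \<Rightarrow> nat \<Rightarrow> real" where
  "cap_min C k = Min (range (\<lambda>i. cap C i k))"

definition cap_max :: "'i::finite ctm \<Rightarrow> nat \<Rightarrow> real" where
  "cap_max C k = Max (range (\<lambda>i. cap C i k))"

text \<open>The common maximal capacity, read off at the first cell; \<open>valid_ctm\<close> below requires that it
  is the maximal capacity of every cell.\<close>

definition Fmax :: "'i::finite ctm \<Rightarrow> real" where
  "Fmax C = cap_max C 1"

text \<open>For a finite-state continuous-time chain, ergodicity means that all states communicate
  (positive recurrence is then automatic and periodicity does not arise).\<close>

definition ergodic_rates :: "('i::finite \<Rightarrow> 'i \<Rightarrow> real) \<Rightarrow> bool" where
  "ergodic_rates q \<longleftrightarrow> (\<forall>i j. (i, j) \<in> {(a, b). q a b > 0}\<^sup>*)"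

definition valid_ctm :: "'i::finite ctm \<Rightarrow> bool" where
  "valid_ctm C \<longleftrightarrow>
     num_cells C \<ge> 1 \<and> ff_speed C > 0 \<and> cw_speed C > 0 \<and> jam_density C > 0 \<and>
     (\<forall>k\<in>{1..num_cells C}. 0 < ratio C k \<and> ratio C k \<le> 1) \<and>
     (\<forall>i. \<forall>k\<in>{1..num_cells C}. cap C i k \<ge> 0) \<and>
     (\<forall>k\<in>{1..num_cells C}. cap_max C k = Fmax C) \<and>
     Fmax C \<le> ff_speed C * cw_speed C / (ff_speed C + cw_speed C) * jam_density C \<and>
     (\<forall>i j. rate C i j \<ge> 0) \<and> (\<forall>i. rate C i i = 0) \<and>
     ergodic_rates (rate C)"

definition rate_matrix :: "('i::finite \<Rightarrow> 'i \<Rightarrow> real) \<Rightarrow> real ^ 'i ^ 'i" where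
  "rate_matrix q = (\<chi> i j. if i = j then - (\<Sum>l\<in>UNIV. q i l) else q i j)"

definition steady_state :: "('i::finite \<Rightarrow> 'i \<Rightarrow> real) \<Rightarrow> real ^ 'i \<Rightarrow> bool" where
  "steady_state q p \<longleftrightarrow>
     p v* rate_matrix q = 0 \<and> (\<Sum>i\<in>UNIV. p $ i) = 1 \<and> (\<forall>i. p $ i \<ge> 0)"

text \<open>The transition probabilities \<open>P t = exp (t \<Lambda>)\<close>, given by Kolmogorov's forward equation.\<close>

definition transition_function :: "('i::finite \<Rightarrow> 'i \<Rightarrow> real) \<Rightarrow> (real \<Rightarrow> real ^ 'i ^ 'i) \<Rightarrow> bool" where
  "transition_function q P \<longleftrightarrow>
     P 0 = mat 1 \<and>
     (\<forall>t\<ge>0. (P has_vector_derivative (P t ** rate_matrix q)) (at t within {0..}))"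

text \<open>A continuous-time Markov chain with rates \<open>q\<close>: its finite-dimensional distributions are given
  by the transition function, and almost every path is right-continuous with left limits for the
  discrete topology on the modes.\<close>

definition markov_chain ::
    "('i::finite \<Rightarrow> 'i \<Rightarrow> real) \<Rightarrow> 'w measure \<Rightarrow> (real \<Rightarrow> 'w \<Rightarrow> 'i) \<Rightarrow> bool" where
  "markov_chain q M X \<longleftrightarrow>
     prob_space M \<and>
     (\<forall>t\<ge>0. X t \<in> measurable M (count_space UNIV)) \<and>
     (\<exists>P. transition_function q P \<and>
        (\<forall>(m::nat) (t::nat \<Rightarrow> real) (j::nat \<Rightarrow> 'i).
           0 \<le> t 0 \<longrightarrow> (\<forall>l<m. t l \<le> t (Suc l)) \<longrightarrow>
           measure M {\<omega> \<in> space M. \<forall>l\<le>m. X (t l) \<omega> = j l} =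
             measure M {\<omega> \<in> space M. X (t 0) \<omega> = j 0} *
             (\<Prod>l<m. P (t (Suc l) - t l) $ j l $ j (Suc l)))) \<and>
     (AE \<omega> in M.
        (\<forall>t\<ge>0. eventually (\<lambda>s. X s \<omega> = X t \<omega>) (at_right t)) \<and>
        (\<forall>t>0. \<exists>j. eventually (\<lambda>s. X s \<omega> = j) (at_left t)))"

definition sending :: "'i ctm \<Rightarrow> 'i \<Rightarrow> nat \<Rightarrow> real \<Rightarrow> real" where
  "sending C i k x = min (ff_speed C * x) (cap C i k)"

text \<open>\<open>R\<^sub>k\<close>, the same function for every cell \<open>k \<ge> 2\<close>.\<close>

definition receiving :: "'i ctm \<Rightarrow> real \<Rightarrow> real" where
  "receiving C x = cw_speed C * (jam_density C - x)"

definition flow :: "'i ctm \<Rightarrow> (nat \<Rightarrow> real) \<Rightarrow> 'i \<Rightarrow> (nat \<Rightarrow> real) \<Rightarrow> nat \<Rightarrow> real" where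
  "flow C r i n k =
     (if k = 0 then 0
      else if k < num_cells C then
        min (ratio C k * sending C i k (n k))
            (max (receiving C (n (k + 1)) - r (k + 1)) 0)
      else ratio C k * sending C i k (n k))"

definition field_G :: "'i ctm \<Rightarrow> (nat \<Rightarrow> real) \<Rightarrow> 'i \<Rightarrow> (nat \<Rightarrow> real) \<Rightarrow> nat \<Rightarrow> real" where
  "field_G C r i n k = flow C r i n (k - 1) + r k - flow C r i n k / ratio C k"

definition state_space :: "'i ctm \<Rightarrow> (nat \<Rightarrow> real) set" where
  "state_space C =
     (\<Pi>\<^sub>E k\<in>{1..num_cells C}. if k = 1 then {0..} else {0..jam_density C})"

text \<open>\<open>(I, N)\<close> is the process on \<open>M\<close> with inflow \<open>r\<close> started from \<open>(i, n)\<close>. That the path stays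
  in \<open>state_space C\<close> is not demanded: it can fail for large \<open>r\<close>, and the integral equation
  determines the path in any case.\<close>

definition ss_ctm_process ::
    "'i::finite ctm \<Rightarrow> (nat \<Rightarrow> real) \<Rightarrow> 'i \<Rightarrow> (nat \<Rightarrow> real) \<Rightarrow> 'w measure \<Rightarrow>
     (real \<Rightarrow> 'w \<Rightarrow> 'i) \<Rightarrow> (real \<Rightarrow> 'w \<Rightarrow> nat \<Rightarrow> real) \<Rightarrow> bool" where
  "ss_ctm_process C r i n M I N \<longleftrightarrow>
     markov_chain (rate C) M I \<and>
     (AE \<omega> in M. I 0 \<omega> = i) \<and>
     (\<forall>t\<ge>0. \<forall>k\<in>{1..num_cells C}. (\<lambda>\<omega>. N t \<omega> k) \<in> borel_measurable M) \<and>
     (AE \<omega> in M. \<forall>t\<ge>0. \<forall>k\<in>{1..num_cells C}.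
        ((\<lambda>\<tau>. field_G C r (I \<tau> \<omega>) (N \<tau> \<omega>) k) has_integral (N t \<omega> k - n k)) {0..t})"

text \<open>The initial condition \<open>(i, n)\<close> may be realised on a probability space \<open>M i n\<close> of its own.
  Expectation and time integral are those of nonnegative extended reals.\<close>

definition ss_ctm_stable ::
    "'i::finite ctm \<Rightarrow> ('i \<Rightarrow> (nat \<Rightarrow> real) \<Rightarrow> 'w measure) \<Rightarrow>
     ('i \<Rightarrow> (nat \<Rightarrow> real) \<Rightarrow> real \<Rightarrow> 'w \<Rightarrow> nat \<Rightarrow> real) \<Rightarrow> bool" where
  "ss_ctm_stable C M N \<longleftrightarrow>
     (\<exists>B::real. \<forall>i. \<forall>n\<in>state_space C.
        Limsup at_top (\<lambda>t::real.
          (\<integral>\<^sup>+ \<tau>\<in>{0..t}. (\<integral>\<^sup>+ \<omega>. ennreal (exp (\<Sum>k=1..num_cells C. N i n \<tau> \<omega> k)) \<partial>M i n) \<partial>lborel)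
            / ennreal t) \<le> ennreal B)"

fun lower_bd :: "'i::finite ctm \<Rightarrow> (nat \<Rightarrow> real) \<Rightarrow> nat \<Rightarrow> real" where
  "lower_bd C r 0 = 0"  \<comment> \<open>unused\<close>
| "lower_bd C r (Suc 0) = min (r 1 / ff_speed C) (Fmax C / ff_speed C)"
| "lower_bd C r (Suc (Suc k)) =
     Min {ratio C (Suc k) * lower_bd C r (Suc k) + r (Suc (Suc k)) / ff_speed C,
          (ratio C (Suc k) * cap_min C (Suc k) + r (Suc (Suc k))) / ff_speed C,
          Fmax C / ff_speed C}"

definition adj_cap :: "'i ctm \<Rightarrow> (nat \<Rightarrow> real) \<Rightarrow> (nat \<Rightarrow> real) \<Rightarrow> 'i \<Rightarrow> nat \<Rightarrow> real" where
  "adj_cap C nl r i k =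
     (if k < num_cells C then
        min (cap C i k)
            (1 / ratio C k * max (receiving C (nl (k + 1)) - r (k + 1)) 0)
      else cap C i k)"

text \<open>\<open>ratio_prod C h k\<close> is \<open>\<beta>\<^sub>h\<^sup>k\<close>; the empty product gives \<open>\<beta>\<^sub>k\<^sup>k = 1\<close>.\<close>

definition ratio_prod :: "'i ctm \<Rightarrow> nat \<Rightarrow> nat \<Rightarrow> real" where
  "ratio_prod C h k = (\<Prod>l=h..<k. ratio C l)"

end

theory Submission imports Defs begin

text \<open>
  Start the densities at the lower boundary \<open>lower_bd\<close>. The region above it is invariant, since a
  cell at or below its boundary has nonnegative net inflow; there the flow out of cell \<open>k\<close> divided
  by \<open>\<beta>\<^sub>k\<close> is at most the spillback-adjusted capacity \<open>\<phi> (I \<tau>)\<close> of the current mode. In the weighted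
  sum \<open>W = (\<Sum>h\<le>k. \<beta>\<^sub>h\<^sup>k N\<^sub>h)\<close> the internal flows telescope, so \<open>W t \<ge> t S - \<integral> \<phi> (I \<tau>) d\<tau>\<close> with
  \<open>S = (\<Sum>h\<le>k. \<beta>\<^sub>h\<^sup>k r\<^sub>h)\<close>. Solving the Poisson equation \<open>\<Lambda> x = \<phi> - p \<bullet> \<phi>\<close> and integrating Kolmogorov's
  forward equation against \<open>x\<close> shows that the expectation of the integral is \<open>t (p \<bullet> \<phi>) + O(1)\<close>. If
  \<open>S > p \<bullet> \<phi>\<close>, then \<open>E (exp |N t|) \<ge> E (W t)\<close> grows linearly, which contradicts stability.
\<close>

section \<open>Occupation times of the mode process\<close>

text \<open>Rows of the generator sum to zero, so it acts through differences; this is the form that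
  a maximum principle can use.\<close>

lemma rate_matrix_mult_nth:
  fixes q :: "'i::finite \<Rightarrow> 'i \<Rightarrow> real"
  assumes "q i i = 0"
  shows "(rate_matrix q *v x) $ i = (\<Sum>l\<in>UNIV. q i l * (x $ l - x $ i))"
proof -
  have "(rate_matrix q *v x) $ i
      = (\<Sum>l\<in>UNIV. (if i = l then - (\<Sum>l\<in>UNIV. q i l) else q i l) * x $ l)"
    by (simp add: matrix_vector_mult_def rate_matrix_def)
  also have "\<dots> = (\<Sum>l\<in>UNIV. q i l * x $ l + (if l = i then - (\<Sum>l\<in>UNIV. q i l) * x $ i else 0))"
    by (intro sum.cong refl) (use assms in auto)
  also have "\<dots> = (\<Sum>l\<in>UNIV. q i l * x $ l) - (\<Sum>l\<in>UNIV. q i l) * x $ i"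
    by (simp add: sum.distrib)
  also have "\<dots> = (\<Sum>l\<in>UNIV. q i l * (x $ l - x $ i))"
    by (simp add: right_diff_distrib sum_subtractf sum_distrib_right)
  finally show ?thesis .
qed

text \<open>Maximum principle: the set where \<open>x\<close> is maximal is closed under transitions.\<close>

lemma rate_matrix_kernel_constant:
  fixes q :: "'i::finite \<Rightarrow> 'i \<Rightarrow> real"
  assumes nonneg: "\<And>i j. q i j \<ge> 0" and diag: "\<And>i. q i i = 0"
    and erg: "ergodic_rates q" and ker: "rate_matrix q *v x = 0"
  shows "x $ i = x $ j"
proof -
  define m where "m = Max (range (\<lambda>i. x $ i))"
  have le: "x $ l \<le> m" for l
    unfolding m_def by (intro Max_ge) auto
  have "m \<in> range (\<lambda>i. x $ i)"
    unfolding m_def by (intro Max_in) auto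
  then obtain i0 where i0: "x $ i0 = m" by auto
  have step: "x $ b = m" if a: "x $ a = m" and ab: "q a b > 0" for a b
  proof -
    \<comment> \<open>At a maximal state the equation is a vanishing sum of nonnegative terms, so
      every term vanishes and each successor is maximal too.\<close>
    have "(\<Sum>l\<in>UNIV. q a l * (m - x $ l)) = - (rate_matrix q *v x) $ a"
      by (simp add: rate_matrix_mult_nth diag a right_diff_distrib sum_subtractf)
    then have "(\<Sum>l\<in>UNIV. q a l * (m - x $ l)) = 0"
      by (simp add: ker)
    then have "q a b * (m - x $ b) = 0"
      by (subst (asm) sum_nonneg_eq_0_iff) (auto simp: nonneg le)
    with ab show ?thesis by simp
  qed
  have "x $ k = m" for k
  proof -
    have "(i0, k) \<in> {(a, b). q a b > 0}\<^sup>*"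
      using erg by (simp add: ergodic_rates_def)
    then show ?thesis
      by (induction rule: rtrancl_induct) (use i0 step in blast)+
  qed
  then show ?thesis by simp
qed

text \<open>The operator \<open>x \<mapsto> \<Lambda> x + (p \<bullet> x) 1\<close> is injective, hence surjective.\<close>

lemma poisson_equation_solvable:
  fixes q :: "'i::finite \<Rightarrow> 'i \<Rightarrow> real"
  assumes nonneg: "\<And>i j. q i j \<ge> 0" and diag: "\<And>i. q i i = 0"
    and erg: "ergodic_rates q" and p: "steady_state q p" and y: "p \<bullet> y = 0"
  shows "\<exists>x. rate_matrix q *v x = y"
proof -
  define L where "L x = rate_matrix q *v x + (p \<bullet> x) *\<^sub>R (1 :: real^'i)" for x
  have p1: "p \<bullet> 1 = 1"
    using p by (simp add: steady_state_def inner_vec_def)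
  have p_range: "p \<bullet> (rate_matrix q *v x) = 0" for x
    using p by (simp add: steady_state_def dot_lmul_matrix[symmetric])
  \<comment> \<open>Pairing with \<open>p\<close> kills the range of the generator and leaves the
    rank-one term. So \<open>L x = y\<close> with \<open>p \<bullet> y = 0\<close> forces
    \<open>p \<bullet> x = 0\<close>, and \<open>x\<close> then solves the original
    equation.\<close>
  have pL: "p \<bullet> L x = p \<bullet> x" for x
    by (simp add: L_def inner_add_right p_range p1)
  have lin: "linear L"
    unfolding L_def
    by (intro linearI)
      (simp_all add: matrix_vector_right_distrib matrix_vector_mult_scaleR inner_add_right
        scaleR_add_left scaleR_add_right)
  have "x = 0" if "L x = 0" for x
  proof -
    have px: "p \<bullet> x = 0"
      using pL[of x] that by simp
    then have "rate_matrix q *v x = 0"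
      using that by (simp add: L_def)
    then have "x $ i = x $ j" for i j
      by (rule rate_matrix_kernel_constant[OF nonneg diag erg])
    then have c: "x = x $ undefined *\<^sub>R 1"
      by (simp add: vec_eq_iff)
    then have "p \<bullet> x = x $ undefined"
      by (metis inner_scaleR_right p1 mult.right_neutral)
    with px c show ?thesis by simp
  qed
  then have "inj L"
    by (simp add: linear_injective_0[OF lin])
  then have "surj L"
    by (rule linear_inj_imp_surj[OF lin])
  then obtain x where x: "L x = y"
    by (metis surjD)
  then have "p \<bullet> x = 0"
    using pL[of x] y by simp
  with x show ?thesis
    by (auto simp: L_def)
qed

text \<open>Dynkin's formula in matrix form: the forward equation is paired with a fixed vector and
  integrated. If \<open>x\<close> solves the Poisson equation, the time integral reduces to boundary
  terms.\<close>

lemma transition_function_has_integral: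
  fixes q :: "'i::finite \<Rightarrow> 'i \<Rightarrow> real"
  assumes P: "transition_function q P" and t: "0 \<le> t"
  shows "((\<lambda>\<tau>. (P \<tau> *v (rate_matrix q *v x)) $ i) has_integral ((P t *v x) $ i - x $ i)) {0..t}"
proof -
  have "((\<lambda>\<tau>. (P \<tau> *v x) $ i) has_vector_derivative ((P \<tau> ** rate_matrix q) *v x) $ i)
      (at \<tau> within {0..t})" if "\<tau> \<in> {0..t}" for \<tau>
  proof -
    have "(P has_vector_derivative (P \<tau> ** rate_matrix q)) (at \<tau> within {0..})"
      using P that by (simp add: transition_function_def)
    then have d: "(P has_vector_derivative (P \<tau> ** rate_matrix q)) (at \<tau> within {0..t})"
      by (rule has_vector_derivative_within_subset) auto
    have "bounded_linear (\<lambda>A :: real^'i^'i. (A *v x) $ i)"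
      by (intro linear_conv_bounded_linear[THEN iffD1] linearI)
        (simp_all add: matrix_vector_mult_def sum.distrib distrib_right sum_distrib_left mult.assoc)
    from bounded_linear.has_vector_derivative[OF this d] show ?thesis .
  qed
  from fundamental_theorem_of_calculus[OF t this]
  have "((\<lambda>\<tau>. ((P \<tau> ** rate_matrix q) *v x) $ i) has_integral ((P t *v x) $ i - (P 0 *v x) $ i)) {0..t}"
    by simp
  then show ?thesis
    using P by (simp add: transition_function_def matrix_vector_mul_assoc)
qed

lemma markov_chain_law:
  fixes q :: "'i::finite \<Rightarrow> 'i \<Rightarrow> real"
  assumes mc: "markov_chain q M X" and X0: "AE \<omega> in M. X 0 \<omega> = i"
  obtains P where "transition_function q P"
    and "\<And>\<tau> j. 0 \<le> \<tau> \<Longrightarrow> P \<tau> $ i $ j = measure M {\<omega> \<in> space M. X \<tau> \<omega> = j}"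
proof -
  interpret prob_space M
    using mc by (simp add: markov_chain_def)
  have X[measurable]: "X \<tau> \<in> measurable M (count_space UNIV)" if "0 \<le> \<tau>" for \<tau>
    using mc that by (simp add: markov_chain_def)
  obtain P where P: "transition_function q P"
    and fdd: "\<And>(m::nat) (t::nat \<Rightarrow> real) (j::nat \<Rightarrow> 'i).
      0 \<le> t 0 \<Longrightarrow> (\<forall>l<m. t l \<le> t (Suc l)) \<Longrightarrow>
      measure M {\<omega> \<in> space M. \<forall>l\<le>m. X (t l) \<omega> = j l} =
        measure M {\<omega> \<in> space M. X (t 0) \<omega> = j 0} *
        (\<Prod>l<m. P (t (Suc l) - t l) $ j l $ j (Suc l))"
    using mc unfolding markov_chain_def by blast
  have "P \<tau> $ i $ j = measure M {\<omega> \<in> space M. X \<tau> \<omega> = j}" if \<tau>: "0 \<le> \<tau>" for \<tau> j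
  proof -
    note [measurable] = X[OF \<tau>] X[OF order_refl]
    have start: "measure M {\<omega> \<in> space M. X 0 \<omega> = i} = 1"
      using X0 by (subst prob_Collect_eq_1) auto
    \<comment> \<open>The finite-dimensional law is used with the two times 0 and \<tau>. Since the
      start is almost surely \<open>i\<close>, the joint probability is the one-time
      probability.\<close>
    have "(\<forall>l\<le>Suc 0. X (if l = 0 then 0 else \<tau>) \<omega> = (if l = 0 then i else j))
        \<longleftrightarrow> X 0 \<omega> = i \<and> X \<tau> \<omega> = j" for \<omega>
      by (auto simp: le_Suc_eq)
    then have "measure M {\<omega> \<in> space M. X 0 \<omega> = i \<and> X \<tau> \<omega> = j} = P \<tau> $ i $ j"
      using fdd[of "\<lambda>l. if l = 0 then 0 else \<tau>" "Suc 0" "\<lambda>l. if l = 0 then i else j"] \<tau>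
      by (simp add: start)
    moreover have "measure M {\<omega> \<in> space M. X 0 \<omega> = i \<and> X \<tau> \<omega> = j}
        = measure M {\<omega> \<in> space M. X \<tau> \<omega> = j}"
      using X0 by (intro measure_eq_AE) auto
    ultimately show ?thesis by simp
  qed
  with P show ?thesis by (rule that)
qed

lemma nn_integral_finite_valued:
  fixes f :: "'w \<Rightarrow> 'i::finite" and g :: "'i \<Rightarrow> real"
  assumes "prob_space M" and [measurable]: "f \<in> measurable M (count_space UNIV)"
    and g: "\<And>j. 0 \<le> g j"
  shows "(\<integral>\<^sup>+ \<omega>. ennreal (g (f \<omega>)) \<partial>M)
    = ennreal (\<Sum>j\<in>UNIV. measure M {\<omega> \<in> space M. f \<omega> = j} * g j)"
proof -
  interpret prob_space M by fact
  have "(\<integral>\<^sup>+ \<omega>. ennreal (g (f \<omega>)) \<partial>M)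
      = (\<integral>\<^sup>+ \<omega>. (\<Sum>j\<in>UNIV. ennreal (g j) * indicator {\<omega> \<in> space M. f \<omega> = j} \<omega>) \<partial>M)"
  proof (intro nn_integral_cong)
    fix \<omega> assume "\<omega> \<in> space M"
    then have "(\<Sum>j\<in>UNIV. ennreal (g j) * indicator {\<omega> \<in> space M. f \<omega> = j} \<omega>)
        = (\<Sum>j\<in>UNIV. if j = f \<omega> then ennreal (g j) else 0)"
      by (intro sum.cong) (auto simp: indicator_def)
    then show "ennreal (g (f \<omega>)) = (\<Sum>j\<in>UNIV. ennreal (g j) * indicator {\<omega> \<in> space M. f \<omega> = j} \<omega>)"
      by simp
  qed
  also have "\<dots> = (\<Sum>j\<in>UNIV. ennreal (g j) * emeasure M {\<omega> \<in> space M. f \<omega> = j})"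
    by (subst nn_integral_sum) (auto intro!: sum.cong nn_integral_cmult_indicator)
  also have "\<dots> = (\<Sum>j\<in>UNIV. ennreal (measure M {\<omega> \<in> space M. f \<omega> = j} * g j))"
    by (intro sum.cong refl) (simp add: emeasure_eq_measure ennreal_mult g mult.commute)
  also have "\<dots> = ennreal (\<Sum>j\<in>UNIV. measure M {\<omega> \<in> space M. f \<omega> = j} * g j)"
    by (simp add: sum_ennreal g)
  finally show ?thesis .
qed

text \<open>The Poisson equation for the centred \<phi> turns the deviation from \<open>t\<close>
  times the stationary mean into a difference of boundary terms, which stays bounded in
  \<open>t\<close>. The integrals are nonnegative ones, ready for Fubini.\<close>

lemma expected_occupation_bound:
  fixes q :: "'i::finite \<Rightarrow> 'i \<Rightarrow> real" and \<phi> :: "'i \<Rightarrow> real"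
  assumes nonneg: "\<And>i j. q i j \<ge> 0" and diag: "\<And>i. q i i = 0"
    and erg: "ergodic_rates q" and p: "steady_state q p"
    and mc: "markov_chain q M X" and X0: "AE \<omega> in M. X 0 \<omega> = i"
    and \<phi>: "\<And>j. 0 \<le> \<phi> j"
  obtains c where "0 \<le> c" and "\<And>t. 0 \<le> t \<Longrightarrow>
    (\<integral>\<^sup>+ \<tau>\<in>{0..t}. (\<integral>\<^sup>+ \<omega>. ennreal (\<phi> (X \<tau> \<omega>)) \<partial>M) \<partial>lborel)
      \<le> ennreal (t * (\<Sum>j\<in>UNIV. p $ j * \<phi> j) + c)"
proof -
  interpret prob_space M
    using mc by (simp add: markov_chain_def)
  obtain P where P: "transition_function q P"
    and law: "\<And>\<tau> j. 0 \<le> \<tau> \<Longrightarrow> P \<tau> $ i $ j = measure M {\<omega> \<in> space M. X \<tau> \<omega> = j}"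
    using markov_chain_law[OF mc X0] by blast
  define a where "a = (\<Sum>j\<in>UNIV. p $ j * \<phi> j)"
  define y :: "real^'i" where "y = (\<chi> j. \<phi> j - a)"
  have "(\<Sum>j\<in>UNIV. p $ j * a) = a"
    using p by (simp add: steady_state_def flip: sum_distrib_right)
  then have "p \<bullet> y = 0"
    by (simp add: y_def inner_vec_def right_diff_distrib sum_subtractf flip: a_def)
  then obtain x where x: "rate_matrix q *v x = y"
    using poisson_equation_solvable[OF nonneg diag erg p] by blast
  \<comment> \<open>Dominates \<open>(P t *v x) $ i - x $ i\<close> for all \<open>t\<close>,
    because the entries in row \<open>i\<close> of \<open>P t\<close> are probabilities.\<close>
  define c where "c = (\<Sum>j\<in>UNIV. \<bar>x $ j\<bar>) + \<bar>x $ i\<bar>"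
  have "(\<integral>\<^sup>+ \<tau>\<in>{0..t}. (\<integral>\<^sup>+ \<omega>. ennreal (\<phi> (X \<tau> \<omega>)) \<partial>M) \<partial>lborel) \<le> ennreal (t * a + c)"
    if t: "0 \<le> t" for t
  proof -
    let ?g = "\<lambda>\<tau>. \<Sum>j\<in>UNIV. P \<tau> $ i $ j * \<phi> j"
    have mean: "(\<integral>\<^sup>+ \<omega>. ennreal (\<phi> (X \<tau> \<omega>)) \<partial>M) = ennreal (?g \<tau>)" if "0 \<le> \<tau>" for \<tau>
      using mc that \<phi>
      by (subst nn_integral_finite_valued) (auto simp: markov_chain_def law)
    \<comment> \<open>The row sum is the total mass of the law of \<open>X \<tau>\<close>, obtained
      by integrating the constant 1.\<close>
    have one: "(\<Sum>j\<in>UNIV. P \<tau> $ i $ j) = 1" if "0 \<le> \<tau>" for \<tau>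
    proof -
      have "ennreal 1 = ennreal (\<Sum>j\<in>UNIV. P \<tau> $ i $ j)"
        using nn_integral_finite_valued[OF prob_space_axioms, of "X \<tau>" "\<lambda>_. 1"] mc that
        by (simp add: markov_chain_def law emeasure_space_1)
      moreover have "0 \<le> (\<Sum>j\<in>UNIV. P \<tau> $ i $ j)"
        using that by (simp add: law sum_nonneg)
      ultimately show ?thesis
        by (metis ennreal_inj zero_le_one)
    qed
    have Py: "(P \<tau> *v y) $ i + a = ?g \<tau>" if "0 \<le> \<tau>" for \<tau>
      using one[OF that]
      by (simp add: matrix_vector_mult_def y_def right_diff_distrib sum_subtractf
          flip: sum_distrib_right)
    have "((\<lambda>\<tau>. (P \<tau> *v y) $ i + a) has_integral ((P t *v x) $ i - x $ i + t * a)) {0..t}"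
      using transition_function_has_integral[OF P t, of x i] has_integral_const_real[of a 0 t] t
      by (intro has_integral_add) (simp_all add: x)
    then have "(?g has_integral ((P t *v x) $ i - x $ i + t * a)) {0..t}"
      by (rule has_integral_eq[rotated]) (simp add: Py)
    then have "(\<integral>\<^sup>+ \<tau>. ennreal (?g \<tau>) * indicator {0..t} \<tau> \<partial>lborel)
        = ennreal ((P t *v x) $ i - x $ i + t * a)"
      by (intro nn_integral_has_integral_lebesgue') (simp_all add: law \<phi> sum_nonneg)
    also have "(\<integral>\<^sup>+ \<tau>. ennreal (?g \<tau>) * indicator {0..t} \<tau> \<partial>lborel)
        = (\<integral>\<^sup>+ \<tau>\<in>{0..t}. (\<integral>\<^sup>+ \<omega>. ennreal (\<phi> (X \<tau> \<omega>)) \<partial>M) \<partial>lborel)"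
      by (intro nn_integral_cong) (auto simp: mean indicator_def)
    also have "(P t *v x) $ i - x $ i + t * a \<le> t * a + c"
    proof -
      have "(P t *v x) $ i \<le> (\<Sum>j\<in>UNIV. \<bar>x $ j\<bar>)"
        unfolding matrix_vector_mult_def vec_lambda_beta
      proof (intro sum_mono)
        fix j
        have "P t $ i $ j * x $ j \<le> P t $ i $ j * \<bar>x $ j\<bar>"
          using t by (intro mult_left_mono) (auto simp: law)
        also have "\<dots> \<le> 1 * \<bar>x $ j\<bar>"
          using t by (intro mult_right_mono) (auto simp: law)
        finally show "P t $ i $ j * x $ j \<le> \<bar>x $ j\<bar>" by simp
      qed
      then show ?thesis by (simp add: c_def)
    qed
    finally show ?thesis
      by (simp add: ennreal_leI)
  qed
  then show ?thesis
    by (intro that[of c]) (auto simp: c_def a_def sum_nonneg)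
qed

text \<open>Right-continuity gives joint measurability, since \<open>X \<tau>\<close> is the limit of its values at the
  next point of finer and finer grids.\<close>

lemma right_continuous_jointly_measurable_version:
  fixes X :: "real \<Rightarrow> 'w \<Rightarrow> 'i" and \<phi> :: "'i \<Rightarrow> real"
  assumes X: "\<And>t. 0 \<le> t \<Longrightarrow> X t \<in> measurable M (count_space UNIV)"
    and rc: "AE \<omega> in M. \<forall>t\<ge>0. eventually (\<lambda>s. X s \<omega> = X t \<omega>) (at_right t)"
  obtains Z where "Z \<in> borel_measurable (lborel \<Otimes>\<^sub>M M)"
    and "AE \<omega> in M. \<forall>\<tau>\<ge>0. Z (\<tau>, \<omega>) = \<phi> (X \<tau> \<omega>)"
proof -
  \<comment> \<open>The least multiple of 1 / (n + 1) strictly after \<tau>; strictness lets the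
    grid points converge along \<open>at_right \<tau>\<close>.\<close>
  define grid where "grid n \<tau> = (real_of_int \<lfloor>real (Suc n) * \<tau>\<rfloor> + 1) / real (Suc n)" for n \<tau>
  \<comment> \<open>The \<open>max 0\<close> keeps the time index in the range where
    \<open>X\<close> is known to be measurable; it has no effect for nonnegative \<tau>.\<close>
  define Y where "Y n z = \<phi> (X (max 0 (grid n (fst z))) (snd z))" for n and z :: "real \<times> 'w"
  have Y: "Y n \<in> borel_measurable (lborel \<Otimes>\<^sub>M M)" for n
  proof -
    have m: "(\<lambda>z. \<phi> (X (max 0 ((real_of_int l + 1) / real (Suc n))) (snd z)))
        \<in> borel_measurable (lborel \<Otimes>\<^sub>M M)" for l
    proof -
      have X': "X (max 0 ((real_of_int l + 1) / real (Suc n))) \<in> measurable M (count_space UNIV)"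
        by (rule X) simp
      have "\<phi> \<in> measurable (count_space UNIV) borel" by simp
      then show ?thesis
        by (rule measurable_compose[OF measurable_compose[OF measurable_snd X']])
    qed
    \<comment> \<open>The floor takes countably many values, and for each of them the time is
      fixed.\<close>
    have "(\<lambda>z. \<phi> (X (max 0 ((real_of_int \<lfloor>real (Suc n) * fst z\<rfloor> + 1) / real (Suc n))) (snd z)))
        \<in> borel_measurable (lborel \<Otimes>\<^sub>M M)"
      by (rule measurable_compose_countable[where g = "\<lambda>z. \<lfloor>real (Suc n) * fst z\<rfloor>"]) (rule m, measurable)
    then show ?thesis by (simp only: Y_def[abs_def] grid_def)
  qed
  have grid_gt: "\<tau> < grid n \<tau>" for n \<tau>
  proof -
    have "real (Suc n) * \<tau> < real_of_int \<lfloor>real (Suc n) * \<tau>\<rfloor> + 1"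
      by linarith
    then show ?thesis
      by (simp add: grid_def pos_less_divide_eq mult.commute del: of_nat_Suc)
  qed
  have grid_le: "grid n \<tau> \<le> \<tau> + 1 / real (Suc n)" for n \<tau>
  proof -
    have "grid n \<tau> \<le> (real (Suc n) * \<tau> + 1) / real (Suc n)"
      unfolding grid_def by (intro divide_right_mono) auto
    then show ?thesis
      by (simp add: add_divide_distrib del: of_nat_Suc)
  qed
  have grid_lim: "filterlim (\<lambda>n. grid n \<tau>) (at_right \<tau>) sequentially" for \<tau>
  proof -
    have "(\<lambda>n. grid n \<tau>) \<longlonglongrightarrow> \<tau>"
    proof (rule tendsto_sandwich[OF _ _ tendsto_const])
      show "(\<lambda>n. \<tau> + 1 / real (Suc n)) \<longlonglongrightarrow> \<tau>"
        using tendsto_add[OF tendsto_const[of \<tau>] LIMSEQ_inverse_real_of_nat]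
        by (simp add: inverse_eq_divide)
      show "\<forall>\<^sub>F n in sequentially. \<tau> \<le> grid n \<tau>"
        by (simp add: less_imp_le[OF grid_gt])
      show "\<forall>\<^sub>F n in sequentially. grid n \<tau> \<le> \<tau> + 1 / real (Suc n)"
        by (intro always_eventually allI grid_le)
    qed
    then show ?thesis
      by (intro filterlim_at[THEN iffD2] conjI always_eventually)
        (auto simp: grid_gt less_imp_neq[OF grid_gt, symmetric])
  qed
  have "AE \<omega> in M. \<forall>\<tau>\<ge>0. lim (\<lambda>n. Y n (\<tau>, \<omega>)) = \<phi> (X \<tau> \<omega>)"
    using rc
  proof eventually_elim
    case (elim \<omega>)
    show ?case
    proof (intro allI impI)
      fix \<tau> :: real assume \<tau>: "0 \<le> \<tau>"
      have "eventually (\<lambda>n. X (grid n \<tau>) \<omega> = X \<tau> \<omega>) sequentially"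
        using grid_lim[of \<tau>] elim \<tau> by (auto simp: filterlim_iff)
      then have "eventually (\<lambda>n. Y n (\<tau>, \<omega>) = \<phi> (X \<tau> \<omega>)) sequentially"
      proof eventually_elim
        case (elim n)
        have "0 \<le> grid n \<tau>" using \<tau> grid_gt[of \<tau> n] by linarith
        with elim show ?case by (simp add: Y_def)
      qed
      then show "lim (\<lambda>n. Y n (\<tau>, \<omega>)) = \<phi> (X \<tau> \<omega>)"
        by (intro limI tendsto_eventually)
    qed
  qed
  \<comment> \<open>A pointwise \<open>lim\<close> is measurable whether or not the sequence
    converges, so the exceptional null set need not be removed.\<close>
  moreover have "(\<lambda>z. lim (\<lambda>n. Y n z)) \<in> borel_measurable (lborel \<Otimes>\<^sub>M M)"
    by (intro borel_measurable_lim_metric Y)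
  ultimately show ?thesis using that by blast
qed

section \<open>Density paths\<close>

text \<open>After the last time at which the path was at or above \<open>b\<close>, it is below
  \<open>b\<close>, where its rate is nonnegative; hence it cannot have descended. The argument
  works with the integral equation and does not differentiate \<open>u\<close>.\<close>

lemma integral_path_stays_above:
  fixes u g :: "real \<Rightarrow> real"
  assumes path: "\<And>t. 0 \<le> t \<Longrightarrow> (g has_integral (u t - a)) {0..t}"
    and start: "b \<le> a"
    and push: "\<And>t. 0 \<le> t \<Longrightarrow> u t \<le> b \<Longrightarrow> 0 \<le> g t"
    and t: "0 \<le> t"
  shows "b \<le> u t"
proof (rule ccontr)
  assume "\<not> b \<le> u t"
  have u: "u s = a + integral {0..s} g" if "0 \<le> s" for s
    using integral_unique[OF path[OF that]] by simp
  have "continuous_on {0..t} (\<lambda>s. a + integral {0..s} g)"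
    using path[OF t] by (intro continuous_intros indefinite_integral_continuous_1) blast
  then have cont: "continuous_on {0..t} u"
    by (rule continuous_on_eq) (simp add: u)
  define S where "S = {s \<in> {0..t}. b \<le> u s}"
  have "closed S"
    using continuous_closed_preimage[OF cont, of "{b..}"]
    by (simp add: S_def vimage_def Int_def conj_commute)
  moreover have "bounded S"
    by (rule bounded_subset[of "{0..t}"]) (auto simp: S_def)
  ultimately have "compact S"
    by (simp add: compact_eq_bounded_closed)
  moreover have "0 \<in> S"
    using start t u[of 0] by (simp add: S_def)
  ultimately obtain s where s: "s \<in> S" and max: "\<And>x. x \<in> S \<Longrightarrow> x \<le> s"
    using compact_attains_sup[of S] by blast
  have s0: "0 \<le> s" "s \<le> t" and us: "b \<le> u s"
    using s by (auto simp: S_def)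
  have int: "g integrable_on {0..t}"
    using path[OF t] by (rule has_integral_integrable)
  then have "g integrable_on {s..t}"
    by (rule integrable_on_subinterval) (use s0 in auto)
  moreover have "integral {0..s} g + integral {s..t} g = integral {0..t} g"
    by (rule Henstock_Kurzweil_Integration.integral_combine[OF s0 int])
  ultimately have "(g has_integral (u t - u s)) {s..t}"
    using u[OF t] u[OF s0(1)] by (simp add: has_integral_integrable_integral)
  \<comment> \<open>At \<open>s\<close> itself only \<open>b \<le> u s\<close> is known, which does
    not give the sign of \<open>g s\<close>; one point may be changed freely.\<close>
  then have "((g(s := 0)) has_integral (u t - u s)) {s..t}"
    by (rule has_integral_spike_finite[of "{s}", rotated 2]) auto
  moreover have "0 \<le> (g(s := 0)) x" if "x \<in> {s..t}" for x
  proof (cases "x = s")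
    case False
    then have "x \<notin> S"
      using that max[of x] by auto
    then show ?thesis
      using False that s0 push[of x] by (auto simp: S_def)
  qed simp
  ultimately have "0 \<le> u t - u s"
    by (rule has_integral_nonneg)
  with us \<open>\<not> b \<le> u t\<close> show False by simp
qed

section \<open>Invariance of the region above the lower boundary\<close>

lemma cap_min_le: "cap_min C k \<le> cap C i k"
  unfolding cap_min_def by (intro Min_le) auto

lemma cap_min_nonneg:
  assumes "valid_ctm C" "k \<in> {1..num_cells C}"
  shows "0 \<le> cap_min C k"
  using assms by (auto simp: cap_min_def valid_ctm_def)

lemma Fmax_nonneg:
  assumes "valid_ctm C"
  shows "0 \<le> Fmax C"
proof -
  have "cap C undefined 1 \<le> Fmax C"
    unfolding Fmax_def cap_max_def by (intro Max_ge) auto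
  moreover have "0 \<le> cap C undefined 1"
    using assms by (simp add: valid_ctm_def)
  ultimately show ?thesis by linarith
qed

lemma lower_bd_le_Fmax: "1 \<le> k \<Longrightarrow> lower_bd C r k \<le> Fmax C / ff_speed C"
  by (cases "(C, r, k)" rule: lower_bd.cases) auto

lemma lower_bd_nonneg:
  assumes v: "valid_ctm C" and r: "\<forall>k\<in>{1..num_cells C}. r k \<ge> 0"
  shows "1 \<le> k \<Longrightarrow> k \<le> num_cells C \<Longrightarrow> 0 \<le> lower_bd C r k"
proof (induction k rule: nat_induct_at_least)
  case base
  then show ?case
    using v r Fmax_nonneg[OF v] by (auto simp: valid_ctm_def)
next
  case (Suc k)
  then obtain l where l: "k = Suc l"
    by (cases k) auto
  have "0 < ratio C k" "0 < ff_speed C" "0 \<le> cap_min C k" "0 \<le> r (Suc k)" "0 \<le> lower_bd C r k"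
    using Suc v r cap_min_nonneg[OF v, of k] by (auto simp: valid_ctm_def)
  then show ?case
    using Fmax_nonneg[OF v] by (simp add: l)
qed

text \<open>The first two terms of the minimum in \<open>lower_bd\<close> match the two branches of
  the sending flow upstream, taken at the lower boundary and at the smallest capacity over the
  modes.\<close>

lemma lower_bd_Suc_le:
  assumes v: "valid_ctm C" and k: "1 \<le> k" "k \<le> num_cells C"
    and n: "lower_bd C r k \<le> x"
  shows "ff_speed C * lower_bd C r (Suc k) \<le> ratio C k * sending C i k x + r (Suc k)"
proof -
  obtain l where l: "k = Suc l"
    using k by (cases k) auto
  have pos: "0 < ff_speed C" "0 < ratio C k"
    using v k by (auto simp: valid_ctm_def)
  have "lower_bd C r (Suc k) \<le> ratio C k * lower_bd C r k + r (Suc k) / ff_speed C"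
    "lower_bd C r (Suc k) \<le> (ratio C k * cap_min C k + r (Suc k)) / ff_speed C"
    by (simp_all add: l)
  then have "ff_speed C * lower_bd C r (Suc k) \<le> ratio C k * (ff_speed C * lower_bd C r k) + r (Suc k)"
    "ff_speed C * lower_bd C r (Suc k) \<le> ratio C k * cap_min C k + r (Suc k)"
    using pos by (simp_all add: field_simps)
  moreover have "ratio C k * (ff_speed C * lower_bd C r k) \<le> ratio C k * (ff_speed C * x)"
    using pos n by simp
  moreover have "ratio C k * cap_min C k \<le> ratio C k * cap C i k"
    using pos by (simp add: cap_min_le)
  ultimately show ?thesis
    by (auto simp: sending_def min_def)
qed

text \<open>The bound on \<open>Fmax\<close> says that the triangular fundamental diagram is not truncated: at the
  critical density \<open>Fmax / v\<close> a cell can still receive \<open>Fmax\<close>.\<close>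

lemma receiving_ge_Fmax:
  assumes v: "valid_ctm C" and x: "x \<le> Fmax C / ff_speed C"
  shows "Fmax C \<le> receiving C x"
proof -
  have pos: "0 < ff_speed C" "0 < cw_speed C"
    and F: "Fmax C \<le> ff_speed C * cw_speed C / (ff_speed C + cw_speed C) * jam_density C"
    using v by (auto simp: valid_ctm_def)
  have "Fmax C + cw_speed C * (Fmax C / ff_speed C) \<le> cw_speed C * jam_density C"
    using F pos by (simp add: field_simps)
  moreover have "cw_speed C * x \<le> cw_speed C * (Fmax C / ff_speed C)"
    using pos x by (intro mult_left_mono) auto
  ultimately show ?thesis
    by (simp add: receiving_def right_diff_distrib)
qed

lemma flow_div_ratio_le:
  assumes "valid_ctm C" "k \<in> {1..num_cells C}"
  shows "flow C r i n k / ratio C k \<le> sending C i k (n k)"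
proof -
  have "0 < ratio C k"
    using assms by (auto simp: valid_ctm_def)
  moreover have "flow C r i n k \<le> ratio C k * sending C i k (n k)"
    using assms by (auto simp: flow_def)
  ultimately show ?thesis
    by (simp add: pos_divide_le_eq mult.commute)
qed

text \<open>The outflow is at most what free flow at the boundary density would send. The inflow
  covers this whether it is limited by upstream sending or by receiving.\<close>

lemma field_G_nonneg_below_lower_bd:
  assumes v: "valid_ctm C" and k: "k \<in> {1..num_cells C}"
    and prev: "2 \<le> k \<Longrightarrow> lower_bd C r (k - 1) \<le> n (k - 1)"
    and below: "n k \<le> lower_bd C r k"
  shows "0 \<le> field_G C r i n k"
proof -
  have pos: "0 < ff_speed C"
    using v by (simp add: valid_ctm_def)
  have "flow C r i n k / ratio C k \<le> ff_speed C * n k"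
    using flow_div_ratio_le[OF v k, of r i n] by (simp add: sending_def)
  also have "\<dots> \<le> ff_speed C * lower_bd C r k"
    using pos below by simp
  also have "\<dots> \<le> flow C r i n (k - 1) + r k"
  proof (cases "k = 1")
    case True
    then show ?thesis
      using pos by (simp add: flow_def min_def field_simps)
  next
    case False
    with k obtain l where l: "k = Suc l" "1 \<le> l" "l < num_cells C"
      by (cases k) auto
    have "ff_speed C * lower_bd C r k \<le> ratio C l * sending C i l (n l) + r k"
      using lower_bd_Suc_le[OF v, of l r "n l"] prev l by simp
    \<comment> \<open>If receiving limits the flow, adding back \<open>r k\<close> leaves at least
      \<open>receiving C (n k)\<close>. The third term of the minimum in \<open>lower_bd\<close>
      makes that large enough.\<close>
    moreover have "ff_speed C * lower_bd C r k \<le> Fmax C"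
      using lower_bd_le_Fmax[of k C r] pos l by (simp add: field_simps)
    moreover have "Fmax C \<le> receiving C (n k)"
      using below lower_bd_le_Fmax[of k C r] l by (intro receiving_ge_Fmax[OF v]) auto
    ultimately show ?thesis
      using l by (auto simp: flow_def)
  qed
  finally show ?thesis
    by (simp add: field_G_def)
qed

text \<open>Whether cell \<open>k\<close> is pushed upwards depends on the cell upstream being above
  its boundary at the same instant. Induction along the road, with time left arbitrary, therefore
  reduces invariance to the scalar barrier argument.\<close>

lemma lower_bd_invariant:
  fixes I :: "real \<Rightarrow> 'i::finite" and N :: "real \<Rightarrow> nat \<Rightarrow> real"
  assumes v: "valid_ctm C"
    and path: "\<And>t k. 0 \<le> t \<Longrightarrow> k \<in> {1..num_cells C} \<Longrightarrow>
      ((\<lambda>\<tau>. field_G C r (I \<tau>) (N \<tau>) k) has_integral (N t k - n k)) {0..t}"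
    and start: "\<And>k. k \<in> {1..num_cells C} \<Longrightarrow> lower_bd C r k \<le> n k"
  shows "1 \<le> k \<Longrightarrow> k \<le> num_cells C \<Longrightarrow> 0 \<le> t \<Longrightarrow> lower_bd C r k \<le> N t k"
proof (induction k arbitrary: t rule: nat_induct_at_least)
  case base
  show ?case
  proof (rule integral_path_stays_above[OF path start])
    show "0 \<le> field_G C r (I \<tau>) (N \<tau>) 1" if "N \<tau> 1 \<le> lower_bd C r 1" for \<tau>
      using base that by (intro field_G_nonneg_below_lower_bd[OF v]) auto
  qed (use base in auto)
next
  case (Suc k)
  show ?case
  proof (rule integral_path_stays_above[OF path start])
    show "0 \<le> field_G C r (I \<tau>) (N \<tau>) (Suc k)"
      if "0 \<le> \<tau>" "N \<tau> (Suc k) \<le> lower_bd C r (Suc k)" for \<tau>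
      using Suc.prems Suc.IH[of \<tau>] that by (intro field_G_nonneg_below_lower_bd[OF v]) auto
  qed (use Suc.prems in auto)
qed

section \<open>Flow bounds and the weighted sum of densities\<close>

lemma flow_nonneg:
  assumes v: "valid_ctm C" and k: "k \<in> {1..num_cells C}" and n: "0 \<le> n k"
  shows "0 \<le> flow C r i n k"
proof -
  have "0 < ratio C k" "0 \<le> sending C i k (n k)"
    using assms by (auto simp: sending_def valid_ctm_def)
  then show ?thesis
    using k by (auto simp: flow_def)
qed

lemma adj_cap_nonneg:
  assumes "valid_ctm C" "k \<in> {1..num_cells C}"
  shows "0 \<le> adj_cap C nl r i k"
proof -
  have "0 < ratio C k" "0 \<le> cap C i k"
    using assms by (auto simp: valid_ctm_def)
  then show ?thesis
    by (auto simp: adj_cap_def)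
qed

text \<open>Receiving decreases in the density, so its value at the downstream lower boundary is the
  largest possible.\<close>

lemma flow_div_ratio_le_adj_cap:
  assumes v: "valid_ctm C" and k: "k \<in> {1..num_cells C}"
    and n: "k < num_cells C \<Longrightarrow> nl (k + 1) \<le> n (k + 1)"
  shows "flow C r i n k / ratio C k \<le> adj_cap C nl r i k"
proof -
  have pos: "0 < ratio C k" "0 < cw_speed C"
    using v k by (auto simp: valid_ctm_def)
  have *: "flow C r i n k / ratio C k \<le> cap C i k"
    using flow_div_ratio_le[OF v k, of r i n] by (simp add: sending_def)
  moreover have "flow C r i n k / ratio C k \<le> 1 / ratio C k * max (receiving C (nl (k + 1)) - r (k + 1)) 0"
    if less: "k < num_cells C"
  proof -
    have "flow C r i n k \<le> max (receiving C (n (k + 1)) - r (k + 1)) 0"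
      using less k by (simp add: flow_def)
    also have "receiving C (n (k + 1)) \<le> receiving C (nl (k + 1))"
      using n[OF less] pos by (simp add: receiving_def)
    then have "max (receiving C (n (k + 1)) - r (k + 1)) 0 \<le> max (receiving C (nl (k + 1)) - r (k + 1)) 0"
      by auto
    finally show ?thesis
      using pos by (simp add: divide_right_mono)
  qed
  ultimately show ?thesis
    by (simp add: adj_cap_def)
qed

lemma ratio_prod_Suc: "h \<le> k \<Longrightarrow> ratio_prod C h (Suc k) = ratio C k * ratio_prod C h k"
  by (simp add: ratio_prod_def mult.commute)

lemma sum_ratio_prod_Suc:
  "(\<Sum>h=1..Suc k. ratio_prod C h (Suc k) * a h)
    = ratio C k * (\<Sum>h=1..k. ratio_prod C h k * a h) + a (Suc k)"
proof -
  have "(\<Sum>h=1..k. ratio_prod C h (Suc k) * a h) = ratio C k * (\<Sum>h=1..k. ratio_prod C h k * a h)"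
    unfolding sum_distrib_left by (intro sum.cong) (auto simp: ratio_prod_Suc)
  then show ?thesis
    by (simp add: ratio_prod_def)
qed

lemma ratio_prod_bounds:
  assumes v: "valid_ctm C" and "1 \<le> h" "k \<le> num_cells C"
  shows "0 \<le> ratio_prod C h k" "ratio_prod C h k \<le> 1"
proof -
  have "0 < ratio C l" "ratio C l \<le> 1" if "l \<in> {h..<k}" for l
    using assms that by (auto simp: valid_ctm_def)
  then show "0 \<le> ratio_prod C h k" "ratio_prod C h k \<le> 1"
    unfolding ratio_prod_def by (auto intro!: prod_nonneg prod_le_1 simp: less_imp_le)
qed

text \<open>Cell \<open>h\<close> loses its flow divided by \<open>ratio C h\<close>, while cell
  \<open>h + 1\<close> gains the flow itself. The weights differ by exactly this ratio, so only
  external inflows and the last outflow survive.\<close>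

lemma weighted_field_telescopes:
  assumes v: "valid_ctm C"
  shows "1 \<le> k \<Longrightarrow> k \<le> num_cells C \<Longrightarrow>
    (\<Sum>h=1..k. ratio_prod C h k * field_G C r i n h)
      = (\<Sum>h=1..k. ratio_prod C h k * r h) - flow C r i n k / ratio C k"
proof (induction k rule: nat_induct_at_least)
  case base
  then show ?case
    by (simp add: ratio_prod_def field_G_def flow_def)
next
  case (Suc k)
  have "0 < ratio C k"
    using Suc v by (auto simp: valid_ctm_def)
  with Suc show ?case
    unfolding sum_ratio_prod_Suc by (simp add: field_G_def right_diff_distrib)
qed

text \<open>Integrated mass balance along one path, with the outflow replaced by its capacity bound.
  The additive form in \<open>ennreal\<close> lets expectations be taken term by term without
  subtraction.\<close>

lemma weighted_density_lower_bound:
  fixes I :: "real \<Rightarrow> 'i::finite" and N :: "real \<Rightarrow> nat \<Rightarrow> real"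
  assumes v: "valid_ctm C" and r: "\<forall>k\<in>{1..num_cells C}. r k \<ge> 0"
    and path: "\<And>t k. 0 \<le> t \<Longrightarrow> k \<in> {1..num_cells C} \<Longrightarrow>
      ((\<lambda>\<tau>. field_G C r (I \<tau>) (N \<tau>) k) has_integral (N t k - n k)) {0..t}"
    and start: "\<And>k. k \<in> {1..num_cells C} \<Longrightarrow> lower_bd C r k \<le> n k"
    and k: "k \<in> {1..num_cells C}" and t: "0 \<le> t"
  shows "ennreal (t * (\<Sum>h=1..k. ratio_prod C h k * r h))
    \<le> ennreal (\<Sum>h=1..k. ratio_prod C h k * N t h)
      + (\<integral>\<^sup>+ \<tau>\<in>{0..t}. ennreal (adj_cap C (lower_bd C r) r (I \<tau>) k) \<partial>lborel)"
proof -
  let ?S = "\<Sum>h=1..k. ratio_prod C h k * r h"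
  let ?W = "\<Sum>h=1..k. ratio_prod C h k * N t h"
  let ?V = "\<Sum>h=1..k. ratio_prod C h k * n h"
  let ?f = "\<lambda>\<tau>. flow C r (I \<tau>) (N \<tau>) k / ratio C k"
  have ge: "lower_bd C r h \<le> N \<tau> h" if "0 \<le> \<tau>" "1 \<le> h" "h \<le> num_cells C" for \<tau> h
    using lower_bd_invariant[OF v path start] that by blast
  have nonneg: "0 \<le> N \<tau> h" if "0 \<le> \<tau>" "1 \<le> h" "h \<le> num_cells C" for \<tau> h
    using lower_bd_nonneg[OF v r, of h] ge[of \<tau> h] that by linarith
  have "((\<lambda>\<tau>. \<Sum>h=1..k. ratio_prod C h k * field_G C r (I \<tau>) (N \<tau>) h) has_integral
      (\<Sum>h=1..k. ratio_prod C h k * (N t h - n h))) {0..t}"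
    using k t by (intro has_integral_sum has_integral_mult_right path) auto
  then have "((\<lambda>\<tau>. ?S - ?f \<tau>) has_integral (?W - ?V)) {0..t}"
    using k by (subst (asm) weighted_field_telescopes[OF v])
      (auto simp only: right_diff_distrib sum_subtractf atLeastAtMost_iff)
  from has_integral_diff[OF has_integral_const_real[of ?S 0 t] this]
  have "(?f has_integral (t * ?S - (?W - ?V))) {0..t}"
    using t by simp
  then have "(\<integral>\<^sup>+ \<tau>. ennreal (?f \<tau>) * indicator {0..t} \<tau> \<partial>lborel) = ennreal (t * ?S - (?W - ?V))"
  proof (rule nn_integral_has_integral_lebesgue'[rotated])
    fix \<tau> assume "\<tau> \<in> {0..t}"
    then have "0 \<le> flow C r (I \<tau>) (N \<tau>) k"
      using k by (intro flow_nonneg[OF v k] nonneg) auto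
    moreover have "0 < ratio C k"
      using v k by (auto simp: valid_ctm_def)
    ultimately show "0 \<le> ?f \<tau>" by simp
  qed
  moreover have "(\<integral>\<^sup>+ \<tau>. ennreal (?f \<tau>) * indicator {0..t} \<tau> \<partial>lborel)
      \<le> (\<integral>\<^sup>+ \<tau>\<in>{0..t}. ennreal (adj_cap C (lower_bd C r) r (I \<tau>) k) \<partial>lborel)"
  proof (intro nn_integral_mono)
    fix \<tau> :: real
    have "?f \<tau> \<le> adj_cap C (lower_bd C r) r (I \<tau>) k" if "0 \<le> \<tau>"
      using that by (intro flow_div_ratio_le_adj_cap[OF v k] ge) auto
    then show "ennreal (?f \<tau>) * indicator {0..t} \<tau>
        \<le> ennreal (adj_cap C (lower_bd C r) r (I \<tau>) k) * indicator {0..t} \<tau>"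
      by (auto simp: indicator_def intro: ennreal_leI)
  qed
  \<comment> \<open>\<open>ennreal\<close> sends negative reals to 0, hence the \<open>max 0\<close>
    below; the initial weight \<open>?V\<close> is nonnegative and is dropped.\<close>
  moreover have "ennreal (t * ?S) \<le> ennreal ?W + ennreal (t * ?S - (?W - ?V))"
  proof -
    have "0 \<le> n h" if "1 \<le> h" "h \<le> num_cells C" for h
      using lower_bd_nonneg[OF v r that] start[of h] that by simp
    then have "0 \<le> ?W" "0 \<le> ?V"
      using k t by (auto intro!: sum_nonneg mult_nonneg_nonneg ratio_prod_bounds[OF v] nonneg)
    then have "ennreal (t * ?S) \<le> ennreal (?W + max 0 (t * ?S - (?W - ?V)))"
      by (intro ennreal_leI) linarith
    also have "\<dots> = ennreal ?W + ennreal (t * ?S - (?W - ?V))"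
      using \<open>0 \<le> ?W\<close> by (subst ennreal_plus) (auto simp: max_def ennreal_neg)
    finally show ?thesis .
  qed
  ultimately show ?thesis
    by (auto intro: order_trans add_left_mono)
qed

lemma weighted_sum_le_exp_sum:
  assumes v: "valid_ctm C" and k: "k \<in> {1..num_cells C}"
    and n: "\<And>h. h \<in> {1..num_cells C} \<Longrightarrow> 0 \<le> n h"
  shows "(\<Sum>h=1..k. ratio_prod C h k * n h) \<le> exp (\<Sum>h=1..num_cells C. n h)"
proof -
  have "(\<Sum>h=1..k. ratio_prod C h k * n h) \<le> (\<Sum>h=1..k. n h)"
    using k n by (intro sum_mono mult_left_le_one_le ratio_prod_bounds[OF v]) auto
  also have "\<dots> \<le> (\<Sum>h=1..num_cells C. n h)"
    using k n by (intro sum_mono2) auto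
  also have "\<dots> \<le> exp (\<Sum>h=1..num_cells C. n h)"
    using exp_ge_add_one_self[of "\<Sum>h=1..num_cells C. n h"] by linarith
  finally show ?thesis .
qed

section \<open>Linear growth of the expected density\<close>

text \<open>On the second half of \<open>{0..t}\<close> the function eventually exceeds
  \<open>2 * b\<close>. Half the interval costs a factor 2, so the average still exceeds
  \<open>b\<close>.\<close>

lemma time_average_unbounded:
  fixes f :: "real \<Rightarrow> ennreal"
  assumes growth: "\<And>t. 0 \<le> t \<Longrightarrow> ennreal (\<delta> * t - c) \<le> f t" and \<delta>: "0 < \<delta>"
  shows "\<not> Limsup at_top (\<lambda>t. (\<integral>\<^sup>+ \<tau>\<in>{0..t}. f \<tau> \<partial>lborel) / ennreal t) \<le> ennreal B"
proof -
  \<comment> \<open>Positive and strictly above \<open>B\<close> also after passing to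
    \<open>ennreal\<close>, even for negative \<open>B\<close>.\<close>
  define b where "b = max B 0 + 1"
  have "\<forall>\<^sub>F t in at_top. ennreal b \<le> (\<integral>\<^sup>+ \<tau>\<in>{0..t}. f \<tau> \<partial>lborel) / ennreal t"
    using eventually_ge_at_top[of "2 * (2 * b + c) / \<delta>"] eventually_gt_at_top[of 0]
  proof eventually_elim
    case (elim t)
    have "2 * b \<le> \<delta> * (t / 2) - c"
      using elim \<delta> by (simp add: field_simps)
    have "ennreal (2 * b) \<le> f \<tau>" if "\<tau> \<in> {t / 2..t}" for \<tau>
    proof -
      have "\<delta> * (t / 2) \<le> \<delta> * \<tau>"
        using that \<delta> by (intro mult_left_mono) auto
      with \<open>2 * b \<le> _\<close> have "ennreal (2 * b) \<le> ennreal (\<delta> * \<tau> - c)"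
        by (intro ennreal_leI) linarith
      also have "\<dots> \<le> f \<tau>"
        using that elim by (intro growth) auto
      finally show ?thesis .
    qed
    then have "(\<integral>\<^sup>+ \<tau>\<in>{t / 2..t}. ennreal (2 * b) \<partial>lborel) \<le> (\<integral>\<^sup>+ \<tau>\<in>{0..t}. f \<tau> \<partial>lborel)"
      using elim by (intro nn_integral_mono) (auto simp: indicator_def)
    moreover have "(\<integral>\<^sup>+ \<tau>\<in>{t / 2..t}. ennreal (2 * b) \<partial>lborel) = ennreal (b * t)"
      using elim by (simp add: nn_integral_cmult_indicator ennreal_mult'' [symmetric]
          mult.commute del: ennreal_mult'')
    ultimately have "ennreal (b * t) / ennreal t \<le> (\<integral>\<^sup>+ \<tau>\<in>{0..t}. f \<tau> \<partial>lborel) / ennreal t"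
      by (intro divide_right_mono_ennreal) simp
    moreover have "ennreal (b * t) / ennreal t = ennreal b"
      using elim by (subst divide_ennreal) (auto simp: b_def)
    ultimately show ?case by simp
  qed
  then have "ennreal b \<le> Limsup at_top (\<lambda>t. (\<integral>\<^sup>+ \<tau>\<in>{0..t}. f \<tau> \<partial>lborel) / ennreal t)"
    by (intro le_Limsup) auto
  moreover have "ennreal B < ennreal b"
    by (simp add: ennreal_less_iff b_def ennreal_lessI)
  ultimately show ?thesis
    by (meson leD order_trans)
qed

text \<open>The expectation of the pathwise mass balance, with the occupation bound inserted after
  exchanging expectation and time integral.\<close>

lemma expected_exp_density_growth:
  fixes C :: "'i::finite ctm" and N :: "real \<Rightarrow> 'w \<Rightarrow> nat \<Rightarrow> real"
  assumes v: "valid_ctm C" and r: "\<forall>k\<in>{1..num_cells C}. r k \<ge> 0"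
    and proc: "ss_ctm_process C r i n M I N"
    and p: "steady_state (rate C) p"
    and start: "\<And>k. k \<in> {1..num_cells C} \<Longrightarrow> lower_bd C r k \<le> n k"
    and k: "k \<in> {1..num_cells C}"
  obtains c where "0 \<le> c" and "\<And>t. 0 \<le> t \<Longrightarrow>
    ennreal (((\<Sum>h=1..k. ratio_prod C h k * r h)
        - (\<Sum>i\<in>UNIV. p $ i * adj_cap C (lower_bd C r) r i k)) * t - c)
      \<le> (\<integral>\<^sup>+ \<omega>. ennreal (exp (\<Sum>k=1..num_cells C. N t \<omega> k)) \<partial>M)"
proof -
  have mc: "markov_chain (rate C) M I" and I0: "AE \<omega> in M. I 0 \<omega> = i"
    and N_meas: "\<And>t k. 0 \<le> t \<Longrightarrow> k \<in> {1..num_cells C} \<Longrightarrow> (\<lambda>\<omega>. N t \<omega> k) \<in> borel_measurable M"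
    and path: "AE \<omega> in M. \<forall>t\<ge>0. \<forall>k\<in>{1..num_cells C}.
        ((\<lambda>\<tau>. field_G C r (I \<tau> \<omega>) (N \<tau> \<omega>) k) has_integral (N t \<omega> k - n k)) {0..t}"
    using proc by (auto simp: ss_ctm_process_def)
  interpret prob_space M
    using mc by (simp add: markov_chain_def)
  interpret pair_sigma_finite lborel M ..
  define \<phi> where "\<phi> j = adj_cap C (lower_bd C r) r j k" for j
  have \<phi>: "0 \<le> \<phi> j" for j
    unfolding \<phi>_def by (rule adj_cap_nonneg[OF v k])
  define S where "S = (\<Sum>h=1..k. ratio_prod C h k * r h)"
  define a where "a = (\<Sum>j\<in>UNIV. p $ j * \<phi> j)"
  have rates: "rate C i j \<ge> 0" "rate C i i = 0" "ergodic_rates (rate C)" for i j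
    using v by (auto simp: valid_ctm_def)
  obtain c where c: "0 \<le> c" and occ: "\<And>t. 0 \<le> t \<Longrightarrow>
      (\<integral>\<^sup>+ \<tau>\<in>{0..t}. (\<integral>\<^sup>+ \<omega>. ennreal (\<phi> (I \<tau> \<omega>)) \<partial>M) \<partial>lborel) \<le> ennreal (t * a + c)"
    by (rule expected_occupation_bound[of "rate C" p M I i \<phi>, OF rates p mc I0 \<phi>, folded a_def])
      (rule that)
  have I_meas: "I t \<in> measurable M (count_space UNIV)" if "0 \<le> t" for t
    using mc that by (simp add: markov_chain_def)
  have "AE \<omega> in M. (\<forall>t\<ge>0. eventually (\<lambda>s. I s \<omega> = I t \<omega>) (at_right t)) \<and>
      (\<forall>t>0. \<exists>j. eventually (\<lambda>s. I s \<omega> = j) (at_left t))"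
    using mc by (simp add: markov_chain_def)
  then have I_rc: "AE \<omega> in M. \<forall>t\<ge>0. eventually (\<lambda>s. I s \<omega> = I t \<omega>) (at_right t)"
    by eventually_elim blast
  \<comment> \<open>Fubini needs joint measurability, which the process has only after modification
    on a null set of paths; \<open>Z\<close> stands in for it.\<close>
  obtain Z where Z[measurable]: "Z \<in> borel_measurable (lborel \<Otimes>\<^sub>M M)"
    and Z_eq: "AE \<omega> in M. \<forall>\<tau>\<ge>0. Z (\<tau>, \<omega>) = \<phi> (I \<tau> \<omega>)"
    by (rule right_continuous_jointly_measurable_version[OF I_meas I_rc, of \<phi>])
      (assumption, rule that)
  have a0: "0 \<le> a"
    using p \<phi> by (auto simp: a_def steady_state_def intro!: sum_nonneg)
  have "ennreal ((S - a) * t - c) \<le> (\<integral>\<^sup>+ \<omega>. ennreal (exp (\<Sum>k=1..num_cells C. N t \<omega> k)) \<partial>M)"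
    if t: "0 \<le> t" for t
  proof -
    let ?W = "\<lambda>\<omega>. \<Sum>h=1..k. ratio_prod C h k * N t \<omega> h"
    have W[measurable]: "?W \<in> borel_measurable M"
      using t k by (intro borel_measurable_sum borel_measurable_times N_meas) auto
    have swap: "(\<integral>\<^sup>+ \<omega>. (\<integral>\<^sup>+ \<tau>\<in>{0..t}. ennreal (Z (\<tau>, \<omega>)) \<partial>lborel) \<partial>M)
        = (\<integral>\<^sup>+ \<tau>\<in>{0..t}. (\<integral>\<^sup>+ \<omega>. ennreal (\<phi> (I \<tau> \<omega>)) \<partial>M) \<partial>lborel)"
    proof -
      have "(\<integral>\<^sup>+ \<omega>. (\<integral>\<^sup>+ \<tau>\<in>{0..t}. ennreal (Z (\<tau>, \<omega>)) \<partial>lborel) \<partial>M)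
          = (\<integral>\<^sup>+ \<tau>. (\<integral>\<^sup>+ \<omega>. ennreal (Z (\<tau>, \<omega>)) * indicator {0..t} \<tau> \<partial>M) \<partial>lborel)"
        by (rule Fubini') measurable
      also have "\<dots> = (\<integral>\<^sup>+ \<tau>\<in>{0..t}. (\<integral>\<^sup>+ \<omega>. ennreal (\<phi> (I \<tau> \<omega>)) \<partial>M) \<partial>lborel)"
      proof (intro nn_integral_cong)
        fix \<tau> :: real
        show "(\<integral>\<^sup>+ \<omega>. ennreal (Z (\<tau>, \<omega>)) * indicator {0..t} \<tau> \<partial>M)
            = (\<integral>\<^sup>+ \<omega>. ennreal (\<phi> (I \<tau> \<omega>)) \<partial>M) * indicator {0..t} \<tau>"
          using Z_eq by (cases "\<tau> \<in> {0..t}") (auto intro!: nn_integral_cong_AE)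
      qed
      finally show ?thesis .
    qed
    have "ennreal (t * S) = (\<integral>\<^sup>+ \<omega>. ennreal (t * S) \<partial>M)"
      by (simp add: emeasure_space_1)
    also have "\<dots> \<le> (\<integral>\<^sup>+ \<omega>. ennreal (?W \<omega>) + (\<integral>\<^sup>+ \<tau>\<in>{0..t}. ennreal (Z (\<tau>, \<omega>)) \<partial>lborel) \<partial>M)"
    proof (rule nn_integral_mono_AE)
      show "AE \<omega> in M. ennreal (t * S)
          \<le> ennreal (?W \<omega>) + (\<integral>\<^sup>+ \<tau>\<in>{0..t}. ennreal (Z (\<tau>, \<omega>)) \<partial>lborel)"
        using path Z_eq
      proof eventually_elim
        case (elim \<omega>)
        have "(\<integral>\<^sup>+ \<tau>\<in>{0..t}. ennreal (Z (\<tau>, \<omega>)) \<partial>lborel)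
            = (\<integral>\<^sup>+ \<tau>\<in>{0..t}. ennreal (\<phi> (I \<tau> \<omega>)) \<partial>lborel)"
          using elim(2) by (intro nn_integral_cong) (simp add: indicator_def)
        moreover have "ennreal (t * S)
            \<le> ennreal (?W \<omega>) + (\<integral>\<^sup>+ \<tau>\<in>{0..t}. ennreal (\<phi> (I \<tau> \<omega>)) \<partial>lborel)"
          unfolding S_def \<phi>_def
          by (rule weighted_density_lower_bound[OF v r _ start k t]) (use elim(1) in blast)+
        ultimately show ?case by simp
      qed
    qed
    also have "\<dots> = (\<integral>\<^sup>+ \<omega>. ennreal (?W \<omega>) \<partial>M)
        + (\<integral>\<^sup>+ \<omega>. (\<integral>\<^sup>+ \<tau>\<in>{0..t}. ennreal (Z (\<tau>, \<omega>)) \<partial>lborel) \<partial>M)"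
      by (rule nn_integral_add) measurable
    also have "\<dots> \<le> (\<integral>\<^sup>+ \<omega>. ennreal (exp (\<Sum>k=1..num_cells C. N t \<omega> k)) \<partial>M) + ennreal (t * a + c)"
    proof (rule add_mono)
      show "(\<integral>\<^sup>+ \<omega>. ennreal (?W \<omega>) \<partial>M) \<le> (\<integral>\<^sup>+ \<omega>. ennreal (exp (\<Sum>k=1..num_cells C. N t \<omega> k)) \<partial>M)"
      proof (rule nn_integral_mono_AE)
        show "AE \<omega> in M. ennreal (?W \<omega>) \<le> ennreal (exp (\<Sum>k=1..num_cells C. N t \<omega> k))"
          using path
        proof eventually_elim
          case (elim \<omega>)
          have "0 \<le> N t \<omega> h" if h: "h \<in> {1..num_cells C}" for h
          proof -
            have "lower_bd C r h \<le> N t \<omega> h"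
              by (rule lower_bd_invariant[where n = n and I = "\<lambda>\<tau>. I \<tau> \<omega>" and N = "\<lambda>\<tau>. N \<tau> \<omega>",
                    OF v _ start])
                (use elim h t in auto)
            then show ?thesis
              using lower_bd_nonneg[OF v r, of h] h by simp
          qed
          then show ?case
            by (intro ennreal_leI weighted_sum_le_exp_sum[OF v k])
        qed
      qed
      show "(\<integral>\<^sup>+ \<omega>. (\<integral>\<^sup>+ \<tau>\<in>{0..t}. ennreal (Z (\<tau>, \<omega>)) \<partial>lborel) \<partial>M) \<le> ennreal (t * a + c)"
        unfolding swap by (rule occ[OF t])
    qed
    finally have "ennreal (t * S) - ennreal (t * a + c)
        \<le> (\<integral>\<^sup>+ \<omega>. ennreal (exp (\<Sum>k=1..num_cells C. N t \<omega> k)) \<partial>M)"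
      by (subst ennreal_minus_le_iff) (simp add: add.commute)
    \<comment> \<open>Truncated subtraction agrees with real subtraction under
      \<open>ennreal\<close> because the subtrahend is nonnegative, by \<open>a0\<close> and
      \<open>0 \<le> c\<close>.\<close>
    also have "ennreal (t * S) - ennreal (t * a + c) = ennreal ((S - a) * t - c)"
      using a0 c t by (subst ennreal_minus) (auto simp: algebra_simps)
    finally show ?thesis .
  qed
  with c show ?thesis
    by (intro that[of c]) (auto simp: S_def a_def \<phi>_def)
qed

text \<open>Stability speaks only about initial densities in the state space, so the chosen start
  must lie there. At the critical density a cell can still receive a nonnegative flow, so that
  density is at most the jam density.\<close>

lemma lower_bd_in_state_space:
  assumes v: "valid_ctm C" and r: "\<forall>k\<in>{1..num_cells C}. r k \<ge> 0"
  shows "restrict (lower_bd C r) {1..num_cells C} \<in> state_space C"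
proof -
  have pos: "0 < ff_speed C" "0 < cw_speed C" "0 < jam_density C"
    and F: "Fmax C \<le> receiving C (Fmax C / ff_speed C)"
    using v receiving_ge_Fmax[OF v, of "Fmax C / ff_speed C"] by (auto simp: valid_ctm_def)
  have "0 \<le> cw_speed C * (jam_density C - Fmax C / ff_speed C)"
    using F Fmax_nonneg[OF v] by (simp add: receiving_def)
  then have "Fmax C / ff_speed C \<le> jam_density C"
    using pos by (simp add: zero_le_mult_iff)
  then have "lower_bd C r k \<le> jam_density C" if "1 \<le> k" for k
    using lower_bd_le_Fmax[OF that, of C r] by linarith
  then show ?thesis
    using lower_bd_nonneg[OF v r]
    by (auto simp: state_space_def restrict_PiE_iff simp del: lower_bd.simps)
qed

theorem theorem1:
  fixes C :: "'i::finite ctm"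
    and r :: "nat \<Rightarrow> real"
    and p :: "real ^ 'i"
    and M :: "'i \<Rightarrow> (nat \<Rightarrow> real) \<Rightarrow> 'w measure"
    and I :: "'i \<Rightarrow> (nat \<Rightarrow> real) \<Rightarrow> real \<Rightarrow> 'w \<Rightarrow> 'i"
    and N :: "'i \<Rightarrow> (nat \<Rightarrow> real) \<Rightarrow> real \<Rightarrow> 'w \<Rightarrow> nat \<Rightarrow> real"
  assumes "valid_ctm C"
    and "\<forall>k\<in>{1..num_cells C}. r k \<ge> 0"
    and "\<And>i n. n \<in> state_space C \<Longrightarrow> ss_ctm_process C r i n (M i n) (I i n) (N i n)"
    and "steady_state (rate C) p"
    and "ss_ctm_stable C M N"
  shows "\<forall>k\<in>{1..num_cells C}.
           (\<Sum>h=1..k. ratio_prod C h k * r h)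
             \<le> (\<Sum>i\<in>UNIV. p $ i * adj_cap C (lower_bd C r) r i k)"
proof
  fix k assume k: "k \<in> {1..num_cells C}"
  define n where "n = restrict (lower_bd C r) {1..num_cells C}"
  \<comment> \<open>Stability covers every initial mode, so any one will do.\<close>
  define i :: 'i where "i = undefined"
  have n: "n \<in> state_space C"
    unfolding n_def by (rule lower_bd_in_state_space[OF assms(1,2)])
  define \<delta> where "\<delta> = (\<Sum>h=1..k. ratio_prod C h k * r h)
    - (\<Sum>i\<in>UNIV. p $ i * adj_cap C (lower_bd C r) r i k)"
  have start: "lower_bd C r l \<le> n l" if "l \<in> {1..num_cells C}" for l
    using that by (simp add: n_def)
  obtain c where "0 \<le> c" and "\<And>t. 0 \<le> t \<Longrightarrow>
      ennreal (\<delta> * t - c) \<le> (\<integral>\<^sup>+ \<omega>. ennreal (exp (\<Sum>k=1..num_cells C. N i n t \<omega> k)) \<partial>M i n)"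
    unfolding \<delta>_def
    using expected_exp_density_growth[OF assms(1,2) assms(3)[OF n] assms(4) start k] by blast
  moreover obtain B :: real where "Limsup at_top (\<lambda>t::real.
      (\<integral>\<^sup>+ \<tau>\<in>{0..t}. (\<integral>\<^sup>+ \<omega>. ennreal (exp (\<Sum>k=1..num_cells C. N i n \<tau> \<omega> k)) \<partial>M i n) \<partial>lborel)
        / ennreal t) \<le> ennreal B"
    using assms(5) n unfolding ss_ctm_stable_def by blast
  ultimately have "\<not> 0 < \<delta>"
    using time_average_unbounded[of \<delta> c
        "\<lambda>t. \<integral>\<^sup>+ \<omega>. ennreal (exp (\<Sum>k=1..num_cells C. N i n t \<omega> k)) \<partial>M i n" B] by blast
  then show "(\<Sum>h=1..k. ratio_prod C h k * r h)
      \<le> (\<Sum>i\<in>UNIV. p $ i * adj_cap C (lower_bd C r) r i k)"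
    by (simp add: \<delta>_def)
qed

end
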